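(* Let $\varepsilon > 0$. There exists a set $A \subseteq \mathbb{N}$ with $d^*_\times(A) > 1 - \varepsilon$ such that whenever $B \subseteq \mathbb{N}$, $t \in \mathbb{Q}_{>0}$ and $k \ge 2$ satisfy $$tB^{\odot k} = \Big\{ t \prod_{i=1}^k b_i : b_1, \dots, b_k \in B,\ b_1 < \dots < b_k \Big\} \subseteq A,$$ the set $B$ is finite.
   Context: $\mathbb{N} = \{1,2,3,\dots\}$. A Følner sequence in the multiplicative semigroup $(\mathbb{N}, \times)$ is a sequence $(\Phi_N)_{N\in\mathbb{N}}$ of finite subsets of $\mathbb{N}$ with $\lim_{N\to\infty} |x\Phi_N \triangle \Phi_N|/|\Phi_N| = 0$ for every $x \in \mathbb{N}$, where $x\Phi_N = \{xy : y \in \Phi_N\}$. The multiplicative upper Banach density of $A \subseteq \mathbb{N}$ is $d^*_\times(A) = \sup_\Phi \limsup_{N\to\infty} |A \cap \Phi_N|/|\Phi_N|$, the supremum over all Følner sequences $\Phi$ in $(\mathbb{N},\times)$. *)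

theory Defs
  imports "HOL-Analysis.Analysis"
begin

text \<open>
  The positive integers are modelled as the elements of \<open>{0<..}\<close> in type \<^typ>\<open>nat\<close>.
  Nonemptiness of the sets is implicit in the division by their cardinality;
  it is stated explicitly because division by zero is total in HOL.
\<close>

definition mult_folner :: "(nat \<Rightarrow> nat set) \<Rightarrow> bool" where
  "mult_folner \<Phi> \<longleftrightarrow>
     (\<forall>N. finite (\<Phi> N) \<and> \<Phi> N \<noteq> {} \<and> \<Phi> N \<subseteq> {0<..}) \<and>
     (\<forall>x>0. (\<lambda>N. real (card (sym_diff ((\<lambda>y. x * y) ` \<Phi> N) (\<Phi> N))) / real (card (\<Phi> N)))
              \<longlonglongrightarrow> 0)"

definition mult_upper_banach_density :: "nat set \<Rightarrow> ereal" where
  "mult_upper_banach_density A =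
     (SUP \<Phi>\<in>Collect mult_folner.
        limsup (\<lambda>N. ereal (real (card (A \<inter> \<Phi> N)) / real (card (\<Phi> N)))))"

definition scaled_prod_set :: "rat \<Rightarrow> nat set \<Rightarrow> nat \<Rightarrow> rat set" where
  "scaled_prod_set t B k =
     {t * (\<Prod>i=1..k. of_nat (b i)) | b. (\<forall>i\<in>{1..k}. b i \<in> B) \<and> strict_mono_on {1..k} b}"

end

theory Submission
  imports Defs "HOL-Computational_Algebra.Primes"
begin

text \<open>
  For a prime \<open>p\<close>, an infinite set \<open>B\<close> has an infinite subset on which \<open>multiplicity p\<close> is constant
  modulo \<open>k\<close>; a product of \<open>k\<close> of its members then has multiplicity divisible by \<open>k\<close>. The same works
  for any finite set \<open>P\<close> of primes simultaneously, and multiplying by a rational \<open>t\<close> composed of other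
  primes changes nothing. So it suffices to remove, for every \<open>m\<close> and \<open>2 \<le> k \<le> m\<close>, all large numbers
  whose multiplicities at every prime of a finite set \<open>P m\<close> of primes above \<open>m\<close> are divisible by \<open>k\<close>.
  In a box of prime exponents these have, for each \<open>k\<close>, relative density at most \<open>(2/3) ^ card (P m)\<close>, which is as
  small as desired. "Large" is measured against the box Folner sequence, so that only those \<open>m\<close>
  matter for a given box whose \<open>P m\<close> lies within the primes of that box.
\<close>

section \<open>Boxes of prime exponents and their cardinalities\<close>

definition exponent_box :: "nat set \<Rightarrow> nat \<Rightarrow> nat set" where
  "exponent_box S M =
     {n. n > 0 \<and> prime_factors n \<subseteq> S \<and> (\<forall>p\<in>S. multiplicity p n < M)}"

text \<open>Unique factorisation identifies the box with a grid of exponent vectors. A separate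
  constraint \<open>D p\<close> on each coordinate keeps the constrained subset a product set, so it
  can be counted one prime at a time.\<close>

lemma bij_betw_exponent_box:
  assumes S: "finite S" "\<And>p. p \<in> S \<Longrightarrow> prime p"
  shows "bij_betw (\<lambda>e. \<Prod>p\<in>S. p ^ e p) (PiE S (\<lambda>p. D p \<inter> {..<M}))
           {n \<in> exponent_box S M. \<forall>p\<in>S. multiplicity p n \<in> D p}"
proof (rule bij_betw_byWitness[where f' = "\<lambda>n. restrict (\<lambda>p. multiplicity p n) S"])
  have mult: "multiplicity p (\<Prod>q\<in>S. q ^ e q) = e p" if "p \<in> S" for p and e :: "nat \<Rightarrow> nat"
    using multiplicity_prod_prime_powers[OF S(1), of p e] S(2) that by auto
  show "\<forall>e\<in>PiE S (\<lambda>p. D p \<inter> {..<M}).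
          restrict (\<lambda>p. multiplicity p (\<Prod>q\<in>S. q ^ e q)) S = e"
    by (auto simp: mult PiE_def extensional_def restrict_def fun_eq_iff)
  show "\<forall>n\<in>{n \<in> exponent_box S M. \<forall>p\<in>S. multiplicity p n \<in> D p}.
          (\<Prod>p\<in>S. p ^ restrict (\<lambda>p. multiplicity p n) S p) = n"
  proof
    fix n assume "n \<in> {n \<in> exponent_box S M. \<forall>p\<in>S. multiplicity p n \<in> D p}"
    then have n: "n > 0" "prime_factors n \<subseteq> S" by (auto simp: exponent_box_def)
    have "(\<Prod>p\<in>S. p ^ restrict (\<lambda>p. multiplicity p n) S p) = (\<Prod>p\<in>S. p ^ multiplicity p n)"
      by (intro prod.cong) auto
    also have "\<dots> = (\<Prod>p\<in>prime_factors n. p ^ multiplicity p n)"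
    proof (rule prod.mono_neutral_right[OF S(1) n(2)], rule ballI)
      fix p assume "p \<in> S - prime_factors n"
      then have "multiplicity p n = 0"
        using S(2) n(1) by (auto simp: prime_factors_multiplicity)
      then show "p ^ multiplicity p n = 1" by simp
    qed
    also have "\<dots> = n" using n(1) prime_factorization_nat[of n] by simp
    finally show "(\<Prod>p\<in>S. p ^ restrict (\<lambda>p. multiplicity p n) S p) = n" .
  qed
  show "(\<lambda>e. \<Prod>p\<in>S. p ^ e p) ` PiE S (\<lambda>p. D p \<inter> {..<M})
          \<subseteq> {n \<in> exponent_box S M. \<forall>p\<in>S. multiplicity p n \<in> D p}"
  proof clarify
    fix e assume e: "e \<in> PiE S (\<lambda>p. D p \<inter> {..<M})"
    have pos: "(\<Prod>p\<in>S. p ^ e p) > 0"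
      using S(2) by (auto intro!: prod_pos simp: prime_gt_0_nat)
    have "prime_factors (\<Prod>p\<in>S. p ^ e p) \<subseteq> S"
    proof
      fix q assume "q \<in> prime_factors (\<Prod>p\<in>S. p ^ e p)"
      then have q: "prime q" "q dvd (\<Prod>p\<in>S. p ^ e p)" by auto
      then obtain p where "p \<in> S" "q dvd p ^ e p"
        using prime_dvd_prod_iff[OF S(1) q(1)] by auto
      then show "q \<in> S"
        using S(2) q(1) by (metis prime_dvd_power primes_dvd_imp_eq)
    qed
    then show "(\<Prod>p\<in>S. p ^ e p) \<in> exponent_box S M
                 \<and> (\<forall>q\<in>S. multiplicity q (\<Prod>p\<in>S. p ^ e p) \<in> D q)"
      using pos e by (auto simp: exponent_box_def mult PiE_def Pi_def)
  qed
  show "(\<lambda>n. restrict (\<lambda>p. multiplicity p n) S)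
          ` {n \<in> exponent_box S M. \<forall>p\<in>S. multiplicity p n \<in> D p}
          \<subseteq> PiE S (\<lambda>p. D p \<inter> {..<M})"
    by (auto simp: exponent_box_def)
qed

lemma card_exponent_box_restricted:
  assumes "finite S" "\<And>p. p \<in> S \<Longrightarrow> prime p"
  shows "card {n \<in> exponent_box S M. \<forall>p\<in>S. multiplicity p n \<in> D p}
           = (\<Prod>p\<in>S. card (D p \<inter> {..<M}))"
  using bij_betw_same_card[OF bij_betw_exponent_box[OF assms, of D M]] assms(1)
  by (simp add: card_PiE)

lemma
  assumes "finite S" "\<And>p. p \<in> S \<Longrightarrow> prime p"
  shows finite_exponent_box: "finite (exponent_box S M)"
    and card_exponent_box: "card (exponent_box S M) = M ^ card S"
proof -
  have "{n \<in> exponent_box S M. \<forall>p\<in>S. multiplicity p n \<in> UNIV} = exponent_box S M" by auto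
  note bij = bij_betw_exponent_box[OF assms, of "\<lambda>_. UNIV" M, unfolded this]
  show "finite (exponent_box S M)"
    using bij_betw_finite[OF bij] assms(1) by (simp add: finite_PiE)
  show "card (exponent_box S M) = M ^ card S"
    using card_exponent_box_restricted[OF assms, of M "\<lambda>_. UNIV"] by simp
qed

text \<open>Exponents at different primes are independent in the box, so each prime of
  \<open>P\<close> costs a factor \<open>c\<close> and the other primes of \<open>S\<close> cost
  nothing. It serves both the Folner property (one prime, exponents near the ceiling) and the
  removed sets (many primes, exponents divisible by \<open>k\<close>).\<close>

lemma card_exponent_box_le:
  assumes S: "finite S" "\<And>p. p \<in> S \<Longrightarrow> prime p" and "P \<subseteq> S"
    and D: "real (card (D \<inter> {..<M})) \<le> c * real M"
  shows "real (card {n \<in> exponent_box S M. \<forall>p\<in>P. multiplicity p n \<in> D})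
           \<le> c ^ card P * real (card (exponent_box S M))"
proof -
  let ?D = "\<lambda>p. if p \<in> P then D else UNIV"
  have "{n \<in> exponent_box S M. \<forall>p\<in>P. multiplicity p n \<in> D}
          = {n \<in> exponent_box S M. \<forall>p\<in>S. multiplicity p n \<in> ?D p}"
    using \<open>P \<subseteq> S\<close> by auto
  then have "real (card {n \<in> exponent_box S M. \<forall>p\<in>P. multiplicity p n \<in> D})
               = (\<Prod>p\<in>S. real (card (?D p \<inter> {..<M})))"
    using card_exponent_box_restricted[OF S, of M ?D] by simp
  also have "\<dots> \<le> (\<Prod>p\<in>S. (if p \<in> P then c else 1) * real M)"
    using D by (intro prod_mono) auto
  also have "\<dots> = (\<Prod>p\<in>S. if p \<in> P then c else 1) * real M ^ card S"
    by (simp add: prod.distrib)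
  also have "(\<Prod>p\<in>S. if p \<in> P then c else 1) = c ^ card P"
    using S(1) \<open>P \<subseteq> S\<close> by (simp add: prod.If_cases Int_absorb1)
  finally show ?thesis by (simp add: card_exponent_box[OF S])
qed

text \<open>The exponent \<open>0\<close> counts as a multiple, so half the range has to be rounded
  up; the constant \<open>2/3\<close> is attained at \<open>M = 3\<close>,
  \<open>k = 2\<close>.\<close>

lemma card_multiples_le:
  fixes k M :: nat
  assumes "k \<ge> 2" "M \<ge> 3"
  shows "real (card ({e. k dvd e} \<inter> {..<M})) \<le> 2/3 * real M"
proof -
  have "{e. k dvd e} \<inter> {..<M} \<subseteq> (\<lambda>j. k * j) ` {..<(M + 1) div 2}"
  proof
    fix e assume "e \<in> {e. k dvd e} \<inter> {..<M}"
    then obtain j where j: "e = k * j" "k * j < M" by auto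
    have "2 * j \<le> k * j" using assms(1) by simp
    then have "j < (M + 1) div 2" using j(2) by linarith
    then show "e \<in> (\<lambda>j. k * j) ` {..<(M + 1) div 2}" using j(1) by auto
  qed
  then have "card ({e. k dvd e} \<inter> {..<M}) \<le> card ((\<lambda>j. k * j) ` {..<(M + 1) div 2})"
    by (intro card_mono) auto
  also have "\<dots> \<le> (M + 1) div 2"
    using card_image_le[of "{..<(M + 1) div 2}" "\<lambda>j. k * j"] by simp
  finally have "3 * card ({e. k dvd e} \<inter> {..<M}) \<le> 2 * M" using assms(2) by linarith
  then show ?thesis by linarith
qed

section \<open>A Folner sequence of nested exponent boxes\<close>

text \<open>The offset \<open>3\<close> makes \<open>card_multiples_le\<close> applicable in every
  box, including the first ones.\<close>

definition folner_box :: "nat \<Rightarrow> nat set" where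
  "folner_box N = exponent_box {p. prime p \<and> p < N} (N + 3)"

lemma finite_primes_less: "finite {p :: nat. prime p \<and> p < N}"
  by (rule finite_subset[of _ "{..<N}"]) auto

lemma finite_folner_box: "finite (folner_box N)"
  unfolding folner_box_def by (rule finite_exponent_box[OF finite_primes_less]) auto

lemma card_folner_box_pos: "card (folner_box N) > 0"
  unfolding folner_box_def by (subst card_exponent_box[OF finite_primes_less]) auto

text \<open>The larger box constrains more primes, but the new ones do not divide \<open>n\<close>
  and have multiplicity \<open>0\<close>.\<close>

lemma folner_box_mono: "N \<le> N' \<Longrightarrow> folner_box N \<subseteq> folner_box N'"
proof
  fix n assume le: "N \<le> N'" and n: "n \<in> folner_box N"
  have "multiplicity p n < N' + 3" if "prime p" for p
  proof (cases "p \<in> prime_factors n")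
    case True
    then have "multiplicity p n < N + 3" using n by (auto simp: folner_box_def exponent_box_def)
    then show ?thesis using le by simp
  next
    case False
    then show ?thesis using that by (auto simp: prime_factors_multiplicity)
  qed
  moreover have "prime_factors n \<subseteq> {p. prime p \<and> p < N'}"
    using n le unfolding folner_box_def exponent_box_def by (auto intro: less_le_trans)
  ultimately show "n \<in> folner_box N'"
    using n by (simp add: folner_box_def exponent_box_def)
qed

lemma multiplicity_le_self:
  fixes p x :: nat
  assumes "prime p" "x > 0"
  shows "multiplicity p x \<le> x"
proof -
  have "multiplicity p x \<le> 2 ^ multiplicity p x"
    using less_exp[of "multiplicity p x"] by simp
  also have "\<dots> \<le> p ^ multiplicity p x" using prime_ge_2_nat[OF assms(1)] by (rule power_mono) simp
  also have "\<dots> \<le> x" using assms(2) by (intro dvd_imp_le multiplicity_dvd)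
  finally show ?thesis .
qed

text \<open>Since \<open>N > x\<close>, multiplication by \<open>x\<close> brings in no prime
  outside the box. So \<open>x * y\<close> can leave only if, at some prime factor of
  \<open>x\<close>, the exponent of \<open>y\<close> is among the top \<open>x\<close> values. Each
  such slab has relative size at most \<open>x / (N + 3)\<close>, and there are at most
  \<open>x\<close> of them.\<close>

lemma card_folner_box_translate_diff:
  assumes x: "x > 0" and N: "N > x"
  shows "real (card ((\<lambda>y. x * y) ` folner_box N - folner_box N))
           \<le> real (x * x) / real (N + 3) * real (card (folner_box N))"
proof -
  let ?S = "{p :: nat. prime p \<and> p < N}" and ?M = "N + 3"
  let ?U = "\<lambda>p. {y \<in> folner_box N. \<forall>q\<in>{p}. multiplicity q y \<in> {?M - x..}}"
  \<comment> \<open>This crude inclusion is used twice: it places the prime factors of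
    \<open>x\<close> below \<open>N\<close>, and it bounds their number by \<open>x\<close>.\<close>
  have pf: "prime_factors x \<subseteq> {1..x}"
    using x by (auto dest: dvd_imp_le simp: in_prime_factors_iff Suc_le_eq prime_gt_0_nat)
  have sub: "(\<lambda>y. x * y) ` folner_box N - folner_box N
               \<subseteq> (\<lambda>y. x * y) ` (\<Union>p\<in>prime_factors x. ?U p)"
  proof clarify
    fix y assume y: "y \<in> folner_box N" and xy: "x * y \<notin> folner_box N"
    have y0: "y > 0" and yS: "prime_factors y \<subseteq> ?S"
      and yM: "\<And>p. p \<in> ?S \<Longrightarrow> multiplicity p y < ?M"
      using y by (auto simp: folner_box_def exponent_box_def)
    have "prime_factors (x * y) = prime_factors x \<union> prime_factors y"
      using x y0 by (simp add: prime_factors_product)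
    moreover have "prime_factors x \<subseteq> ?S" using pf N by force
    ultimately have "prime_factors (x * y) \<subseteq> ?S" using yS by auto
    then obtain p where p: "p \<in> ?S" "multiplicity p (x * y) \<ge> ?M"
      using xy x y0 unfolding folner_box_def exponent_box_def by (auto simp: not_less)
    have sum: "multiplicity p (x * y) = multiplicity p x + multiplicity p y"
      using p(1) x y0 by (intro prime_elem_multiplicity_mult_distrib) auto
    have "multiplicity p x \<noteq> 0" using sum p yM[OF p(1)] by auto
    then have "p \<in> prime_factors x" using p(1) by (auto simp: prime_factors_multiplicity)
    moreover have "multiplicity p y \<ge> ?M - x"
      using sum p multiplicity_le_self[of p x] x by auto
    ultimately show "x * y \<in> (\<lambda>y. x * y) ` (\<Union>p\<in>prime_factors x. ?U p)" using y by auto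
  qed
  have finU: "finite (\<Union>p\<in>prime_factors x. ?U p)" using finite_folner_box by auto
  have U: "real (card (?U p)) \<le> real x / real ?M * real (card (folner_box N))"
    if "p \<in> prime_factors x" for p
  proof -
    have "{?M - x..} \<inter> {..<?M} = {?M - x..<?M}" by auto
    then have "real (card ({?M - x..} \<inter> {..<?M})) \<le> real x / real ?M * real ?M"
      using N by simp
    moreover have "{p} \<subseteq> ?S" using that pf N by force
    ultimately show ?thesis
      unfolding folner_box_def
      using card_exponent_box_le[OF finite_primes_less, of N "{p}" "{?M - x..}" ?M "real x / real ?M"]
      by simp
  qed
  have "card ((\<lambda>y. x * y) ` folner_box N - folner_box N)
          \<le> card ((\<lambda>y. x * y) ` (\<Union>p\<in>prime_factors x. ?U p))"
    using sub finU by (intro card_mono) auto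
  also have "\<dots> \<le> card (\<Union>p\<in>prime_factors x. ?U p)" using finU by (rule card_image_le)
  also have "\<dots> \<le> (\<Sum>p\<in>prime_factors x. card (?U p))" by (rule card_UN_le) simp
  finally have "real (card ((\<lambda>y. x * y) ` folner_box N - folner_box N))
                  \<le> (\<Sum>p\<in>prime_factors x. real (card (?U p)))"
    unfolding of_nat_sum[symmetric] by (rule of_nat_mono)
  also have "\<dots> \<le> (\<Sum>p\<in>prime_factors x. real x / real ?M * real (card (folner_box N)))"
    using U by (intro sum_mono)
  also have "\<dots> = real (card (prime_factors x)) * (real x / real ?M * real (card (folner_box N)))"
    by simp
  also have "\<dots> \<le> real x * (real x / real ?M * real (card (folner_box N)))"
    using card_mono[OF _ pf] by (intro mult_right_mono) auto
  finally show ?thesis by simp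
qed

lemma mult_folner_folner_box: "mult_folner folner_box"
  unfolding mult_folner_def
proof (intro conjI allI impI)
  fix N
  show "finite (folner_box N)" by (rule finite_folner_box)
  show "folner_box N \<noteq> {}" using card_folner_box_pos[of N] by auto
  show "folner_box N \<subseteq> {0<..}" by (auto simp: folner_box_def exponent_box_def)
next
  fix x :: nat assume x: "x > 0"
  have bound: "real (card (sym_diff ((\<lambda>y. x * y) ` folner_box N) (folner_box N)))
                  / real (card (folner_box N)) \<le> 2 * real (x * x) / real (N + 3)"
    if N: "N > x" for N
  proof -
    let ?F = "folner_box N" and ?X = "(\<lambda>y. x * y) ` folner_box N"
    have fin: "finite ?F" "finite ?X" using finite_folner_box by auto
    \<comment> \<open>Multiplication by \<open>x\<close> is injective, so the two one-sided
      differences have equal size; this gives the factor \<open>2\<close>.\<close>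
    have cX: "card ?X = card ?F" using x by (intro card_image) (auto simp: inj_on_def)
    have "card (?X - ?F) + card (?X \<inter> ?F) = card ?X"
      "card (?F - ?X) + card (?F \<inter> ?X) = card ?F"
      using fin by (metis card_Diff_subset_Int card_mono inf_le1 finite_Int le_add_diff_inverse2)+
    then have "card (?F - ?X) = card (?X - ?F)" using cX by (simp add: Int_commute)
    then have "card (sym_diff ?X ?F) \<le> 2 * card (?X - ?F)"
      using card_Un_le[of "?X - ?F" "?F - ?X"] by simp
    then have "real (card (sym_diff ?X ?F)) \<le> 2 * real (card (?X - ?F))" by linarith
    also have "\<dots> \<le> 2 * (real (x * x) / real (N + 3) * real (card ?F))"
      using card_folner_box_translate_diff[OF x N] by simp
    finally show ?thesis using card_folner_box_pos[of N] by (simp add: field_simps)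
  qed
  show "(\<lambda>N. real (card (sym_diff ((\<lambda>y. x * y) ` folner_box N) (folner_box N)))
               / real (card (folner_box N))) \<longlonglongrightarrow> 0"
  proof (rule tendsto_sandwich)
    show "\<forall>\<^sub>F N in sequentially. 0 \<le> real (card (sym_diff ((\<lambda>y. x * y) ` folner_box N) (folner_box N)))
               / real (card (folner_box N))" by simp
    show "\<forall>\<^sub>F N in sequentially. real (card (sym_diff ((\<lambda>y. x * y) ` folner_box N) (folner_box N)))
               / real (card (folner_box N)) \<le> 2 * real (x * x) / real (N + 3)"
      using eventually_gt_at_top[of x] by eventually_elim (rule bound)
    show "(\<lambda>N. 2 * real (x * x) / real (N + 3)) \<longlonglongrightarrow> 0"
      by (rule LIMSEQ_ignore_initial_segment[OF lim_const_over_n])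
  qed simp
qed

section \<open>The removed sets and the density of their complement\<close>

text \<open>Level \<open>m\<close> treats all \<open>k\<close> up to \<open>m\<close> at once, so a
  given \<open>k\<close> can be handled at any sufficiently high level; the proof needs this freedom
  to avoid the primes occurring in \<open>t\<close>.\<close>

definition removed :: "(nat \<Rightarrow> nat set) \<Rightarrow> (nat \<Rightarrow> nat) \<Rightarrow> nat \<Rightarrow> nat set" where
  "removed P L m =
     {n. n \<notin> folner_box (L m) \<and> (\<exists>k\<in>{2..m}. \<forall>p\<in>P m. k dvd multiplicity p n)}"

text \<open>A union bound over at most \<open>m\<close> values of \<open>k\<close>. The condition
  \<open>L m \<le> N\<close> puts all of \<open>P m\<close> among the primes of the box.\<close>

lemma card_removed_Int_folner_box:
  assumes P: "\<And>p. p \<in> P m \<Longrightarrow> prime p \<and> p < L m" and L: "L m \<le> N"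
  shows "real (card (removed P L m \<inter> folner_box N))
           \<le> real m * (2/3) ^ card (P m) * real (card (folner_box N))"
proof -
  let ?S = "{p :: nat. prime p \<and> p < N}"
  let ?V = "\<lambda>k. {n \<in> folner_box N. \<forall>p\<in>P m. multiplicity p n \<in> {e. k dvd e}}"
  have V: "real (card (?V k)) \<le> (2/3) ^ card (P m) * real (card (folner_box N))"
    if "k \<in> {2..m}" for k
    unfolding folner_box_def
  proof (rule card_exponent_box_le[OF finite_primes_less])
    show "P m \<subseteq> ?S" using P L by fastforce
    show "real (card ({e. k dvd e} \<inter> {..<N + 3})) \<le> 2/3 * real (N + 3)"
      using that by (intro card_multiples_le) auto
  qed auto
  have "card (removed P L m \<inter> folner_box N) \<le> card (\<Union>k\<in>{2..m}. ?V k)"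
    using finite_folner_box by (intro card_mono) (auto simp: removed_def)
  also have "\<dots> \<le> (\<Sum>k\<in>{2..m}. card (?V k))" by (rule card_UN_le) simp
  finally have "real (card (removed P L m \<inter> folner_box N)) \<le> (\<Sum>k\<in>{2..m}. real (card (?V k)))"
    unfolding of_nat_sum[symmetric] by (rule of_nat_mono)
  also have "\<dots> \<le> (\<Sum>k\<in>{2..m}. (2/3) ^ card (P m) * real (card (folner_box N)))"
    using V by (intro sum_mono)
  also have "\<dots> = real (m - 1) * ((2/3) ^ card (P m) * real (card (folner_box N)))" by simp
  also have "\<dots> \<le> real m * ((2/3) ^ card (P m) * real (card (folner_box N)))"
    by (intro mult_right_mono) auto
  finally show ?thesis by (simp only: mult.assoc)
qed

text \<open>The bound \<open>1 - \<delta>\<close> holds in every single box, so no limit has to be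
  computed: level \<open>m\<close> takes at most the share \<open>\<delta> / 2 ^ (m + 1)\<close> of
  a box, and these shares sum to less than \<open>\<delta>\<close>.\<close>

lemma density_removed_complement:
  assumes P: "\<And>m p. p \<in> P m \<Longrightarrow> prime p \<and> p < L m" and L: "\<And>m. m \<le> L m"
    and small: "\<And>m. real m * (2/3) ^ card (P m) \<le> \<delta> * (1/2) ^ Suc m" and "\<delta> > 0"
  shows "mult_upper_banach_density ({0<..} - (\<Union>m. removed P L m)) \<ge> ereal (1 - \<delta>)"
proof -
  let ?A = "{0<..} - (\<Union>m. removed P L m)"
  have dens: "1 - \<delta> \<le> real (card (?A \<inter> folner_box N)) / real (card (folner_box N))" for N
  proof -
    let ?F = "folner_box N"
    \<comment> \<open>If \<open>N \<le> L m\<close>, nestedness puts the whole box inside the exempt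
      box of level \<open>m\<close>, so that level removes nothing from it.\<close>
    have sub: "?F - ?A \<inter> ?F \<subseteq> (\<Union>m\<in>{m. L m < N}. removed P L m \<inter> ?F)"
    proof
      fix n assume n: "n \<in> ?F - ?A \<inter> ?F"
      then have "n > 0" by (auto simp: folner_box_def exponent_box_def)
      then obtain m where m: "n \<in> removed P L m" using n by auto
      then have "L m < N"
        using n folner_box_mono[of N "L m"] by (auto simp: removed_def not_less[symmetric])
      then show "n \<in> (\<Union>m\<in>{m. L m < N}. removed P L m \<inter> ?F)" using m n by auto
    qed
    have LN: "{m. L m < N} \<subseteq> {..<N}" using L by (auto intro: le_less_trans)
    then have finL: "finite {m. L m < N}" by (rule finite_subset) simp
    have "card ?F - card (?A \<inter> ?F) = card (?F - ?A \<inter> ?F)"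
      using finite_folner_box by (subst card_Diff_subset) auto
    also have "\<dots> \<le> card (\<Union>m\<in>{m. L m < N}. removed P L m \<inter> ?F)"
      using sub finL finite_folner_box by (intro card_mono) auto
    also have "\<dots> \<le> (\<Sum>m\<in>{m. L m < N}. card (removed P L m \<inter> ?F))"
      using finL by (rule card_UN_le)
    finally have "real (card ?F) - real (card (?A \<inter> ?F))
                    \<le> (\<Sum>m\<in>{m. L m < N}. real (card (removed P L m \<inter> ?F)))"
      unfolding of_nat_sum[symmetric] by linarith
    also have "\<dots> \<le> (\<Sum>m\<in>{m. L m < N}. \<delta> * (1/2) ^ Suc m * real (card ?F))"
    proof (rule sum_mono)
      fix m assume "m \<in> {m. L m < N}"
      then have "real (card (removed P L m \<inter> ?F)) \<le> real m * (2/3) ^ card (P m) * real (card ?F)"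
        using P by (intro card_removed_Int_folner_box) auto
      also have "\<dots> \<le> \<delta> * (1/2) ^ Suc m * real (card ?F)"
        using small by (intro mult_right_mono) auto
      finally show "real (card (removed P L m \<inter> ?F)) \<le> \<delta> * (1/2) ^ Suc m * real (card ?F)" .
    qed
    also have "\<dots> \<le> (\<Sum>m<N. \<delta> * (1/2) ^ Suc m * real (card ?F))"
      using LN \<open>\<delta> > 0\<close> by (intro sum_mono2) auto
    also have "\<dots> = \<delta> * real (card ?F) * (\<Sum>m<N. (1/2) ^ Suc m)"
      by (simp add: sum_distrib_left mult_ac)
    also have "(\<Sum>m<N. (1/2) ^ Suc m :: real) = 1 - (1/2) ^ N"
      by (induction N) (auto simp: field_simps)
    also have "\<delta> * real (card ?F) * (1 - (1/2) ^ N) \<le> \<delta> * real (card ?F) * 1"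
      using \<open>\<delta> > 0\<close> by (intro mult_left_mono) auto
    finally show ?thesis using card_folner_box_pos[of N] by (simp add: field_simps)
  qed
  have "ereal (1 - \<delta>)
          \<le> limsup (\<lambda>N. ereal (real (card (?A \<inter> folner_box N)) / real (card (folner_box N))))"
    using dens by (intro le_Limsup) (auto intro!: always_eventually)
  also have "\<dots> \<le> mult_upper_banach_density ?A"
    unfolding mult_upper_banach_density_def
    by (rule SUP_upper) (simp add: mult_folner_folner_box)
  finally show ?thesis .
qed

section \<open>Products from infinite sets hit a removed set\<close>

text \<open>Pigeonhole on the vector of residues; restricting it to \<open>P\<close> places it in a
  finite function space.\<close>

lemma infinite_subset_multiplicity_cong:
  fixes B P :: "nat set"
  assumes "infinite B" "finite P" "k > 0"
  obtains C a where "C \<subseteq> B" "infinite C" "\<And>b p. b \<in> C \<Longrightarrow> p \<in> P \<Longrightarrow> multiplicity p b mod k = a p"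
proof -
  let ?f = "\<lambda>b. restrict (\<lambda>p. multiplicity p b mod k) P"
  have "?f ` B \<subseteq> PiE P (\<lambda>_. {..<k})" using assms(3) by auto
  then have "finite (?f ` B)" by (rule finite_subset) (simp add: finite_PiE assms(2))
  then obtain b0 where b0: "infinite {b \<in> B. ?f b = ?f b0}"
    using pigeonhole_infinite[OF assms(1)] by blast
  show thesis
  proof (rule that[OF _ b0])
    fix b p assume "b \<in> {b \<in> B. ?f b = ?f b0}" "p \<in> P"
    then show "multiplicity p b mod k = multiplicity p b0 mod k"
      by (auto dest: fun_cong[of _ _ p])
  qed auto
qed

text \<open>The level \<open>m\<close> is chosen after \<open>t\<close> and \<open>k\<close>, then
  the factors after \<open>m\<close>: their multiplicities agree modulo \<open>k\<close> on
  \<open>P m\<close>, and they are large enough to leave the exempt box.\<close>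

lemma scaled_prod_set_meets_removed:
  assumes P: "\<And>m p. p \<in> P m \<Longrightarrow> prime p \<and> m \<le> p" and finP: "\<And>m. finite (P m)"
    and B: "B \<subseteq> {0<..}" "infinite B" and t: "t > 0" and k: "k \<ge> 2"
    and A: "scaled_prod_set t B k \<subseteq> of_nat ` A"
  shows "\<exists>m. \<exists>n\<in>A. n \<in> removed P L m"
proof -
  obtain r' s' where rs': "t = Fract r' s'" "s' > 0" by (cases t) auto
  define r s where "r = nat r'" and "s = nat s'"
  have "r' > 0" using t rs' by (simp add: zero_less_Fract_iff)
  then have rs: "r > 0" "s > 0" "t = of_nat r / of_nat s"
    using rs' by (auto simp: r_def s_def Fract_of_int_quotient)
  \<comment> \<open>Every prime of \<open>P m\<close> now exceeds both \<open>r\<close> and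
    \<open>s\<close>, so the scaling by \<open>t\<close> does not affect its multiplicity; also
    \<open>k \<le> m\<close>.\<close>
  define m where "m = Suc (k + r + s)"
  have ndvd: "\<not> p dvd r" "\<not> p dvd s" if "p \<in> P m" for p
    using P[OF that] rs(1,2) by (auto simp: m_def dest: dvd_imp_le)
  obtain C a where C: "C \<subseteq> B" "infinite C"
    and Ca: "\<And>b p. b \<in> C \<Longrightarrow> p \<in> P m \<Longrightarrow> multiplicity p b mod k = a p"
    using infinite_subset_multiplicity_cong[OF B(2) finP, of k m] k by auto
  obtain T where T: "folner_box (L m) \<subseteq> {..T}"
    using finite_folner_box finite_nat_iff_bounded_le by blast
  \<comment> \<open>Entry \<open>i\<close> of the enumeration is at least \<open>i\<close>, so the
    shift forces \<open>b 1\<close> past \<open>s * (T + 1)\<close>. Even after division by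
    \<open>s\<close> the resulting \<open>n\<close> exceeds \<open>T\<close>.\<close>
  define b where "b = (\<lambda>i. enumerate C (i + s * (T + 1)))"
  have bC: "b i \<in> C" for i unfolding b_def using C(2) by (rule enumerate_in_set)
  have bpos: "b i > 0" for i using bC C(1) B(1) by auto
  have "strict_mono_on {1..k} b"
    using C(2) by (auto simp: strict_mono_on_def b_def intro: enumerate_mono)
  then have "t * (\<Prod>i=1..k. of_nat (b i)) \<in> scaled_prod_set t B k"
    unfolding scaled_prod_set_def using bC C(1) by blast
  then obtain n where n: "n \<in> A" "of_nat n = t * (\<Prod>i=1..k. of_nat (b i))" using A by auto
  have "(of_nat (n * s) :: rat) = of_nat (r * (\<Prod>i=1..k. b i))"
    using n(2) rs by (simp add: field_simps)
  \<comment> \<open>With denominators cleared, multiplicities can be compared within the natural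
    numbers.\<close>
  then have ns: "n * s = r * (\<Prod>i=1..k. b i)" by (simp only: of_nat_eq_iff)
  have prodpos: "(\<Prod>i=1..k. b i) > 0" using bpos by (intro prod_pos) auto
  have "s * (T + 1) \<le> b 1"
    using le_enumerate[OF C(2), of "1 + s * (T + 1)"] unfolding b_def by linarith
  also have "\<dots> \<le> (\<Prod>i=1..k. b i)"
    using k prodpos by (intro dvd_imp_le dvd_prodI) auto
  also have "\<dots> \<le> n * s" using rs(1) ns by simp
  finally have "T + 1 \<le> n" using rs(2) by (metis mult.commute mult_le_cancel1)
  then have "n \<notin> folner_box (L m)" using T by auto
  moreover have "k dvd multiplicity p n" if p: "p \<in> P m" for p
  proof -
    have pr: "prime p" using P p by auto
    have n0: "n > 0" using \<open>T + 1 \<le> n\<close> by simp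
    have "multiplicity p n = multiplicity p (n * s)"
      using pr n0 rs(2) ndvd[OF p]
      by (simp add: prime_elem_multiplicity_mult_distrib not_dvd_imp_multiplicity_0)
    also have "\<dots> = multiplicity p (\<Prod>i=1..k. b i)"
      unfolding ns using pr prodpos rs(1) ndvd[OF p]
      by (subst prime_elem_multiplicity_mult_distrib) (auto simp: not_dvd_imp_multiplicity_0)
    also have "\<dots> = (\<Sum>i=1..k. multiplicity p (b i))"
      using pr bpos by (intro prime_elem_multiplicity_prod_distrib) (auto simp: image_iff)
    also have "\<dots> mod k = (\<Sum>i=1..k. multiplicity p (b i) mod k) mod k"
      by (simp only: mod_sum_eq)
    \<comment> \<open>All \<open>k\<close> summands equal \<open>a p\<close>, so their sum is
      \<open>k * a p\<close>.\<close>
    also have "\<dots> = 0" using Ca[OF bC p] by simp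
    finally show ?thesis by (simp add: mod_eq_0_iff_dvd)
  qed
  moreover have "k \<in> {2..m}" using k by (auto simp: m_def)
  ultimately show ?thesis using n(1) unfolding removed_def by blast
qed

section \<open>Choice of the primes and conclusion\<close>

theorem theorem1p4:
  fixes \<epsilon> :: real
  assumes "\<epsilon> > 0"
  shows "\<exists>A :: nat set. A \<subseteq> {0<..} \<and>
           mult_upper_banach_density A > ereal (1 - \<epsilon>) \<and>
           (\<forall>(B :: nat set) (t :: rat) (k :: nat).
              B \<subseteq> {0<..} \<longrightarrow> t > 0 \<longrightarrow> k \<ge> 2 \<longrightarrow>
              scaled_prod_set t B k \<subseteq> of_nat ` A \<longrightarrow> finite B)"
proof -
  \<comment> \<open>Halving turns the weak density bound \<open>1 - \<delta>\<close> into a strict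
    one for \<open>\<epsilon>\<close>.\<close>
  define \<delta> where "\<delta> = \<epsilon> / 2"
  have \<delta>: "\<delta> > 0" "\<delta> < \<epsilon>" using assms by (auto simp: \<delta>_def)
  \<comment> \<open>First a number \<open>c\<close> of primes is fixed that makes
    \<open>m * (2/3) ^ c\<close> small enough; then any \<open>c\<close> of the infinitely many
    primes from \<open>m\<close> on will do.\<close>
  have "\<exists>Q. finite Q \<and> (\<forall>p\<in>Q. prime p \<and> m \<le> p)
          \<and> real m * (2/3) ^ card Q \<le> \<delta> * (1/2) ^ Suc m" for m :: nat
  proof -
    have "(\<lambda>c. real m * (2/3) ^ c) \<longlonglongrightarrow> real m * 0"
      by (intro tendsto_mult tendsto_const LIMSEQ_realpow_zero) auto
    then have "\<forall>\<^sub>F c in sequentially. real m * (2/3) ^ c < \<delta> * (1/2) ^ Suc m"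
      using \<delta>(1) by (intro order_tendstoD(2)) auto
    then obtain c where c: "real m * (2/3) ^ c < \<delta> * (1/2) ^ Suc m"
      by (auto simp: eventually_sequentially)
    have "{p :: nat. prime p} \<subseteq> {p. prime p \<and> m \<le> p} \<union> {..<m}" by auto
    then have "infinite {p :: nat. prime p \<and> m \<le> p}"
      using primes_infinite finite_subset by blast
    then obtain Q where "finite Q" "card Q = c" "Q \<subseteq> {p. prime p \<and> m \<le> p}"
      using infinite_arbitrarily_large by blast
    then show ?thesis using c by (intro exI[of _ Q]) auto
  qed
  then obtain P :: "nat \<Rightarrow> nat set" where finP: "\<And>m. finite (P m)"
    and P: "\<And>m p. p \<in> P m \<Longrightarrow> prime p \<and> m \<le> p"
    and small: "\<And>m. real m * (2/3) ^ card (P m) \<le> \<delta> * (1/2) ^ Suc m"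
    by metis
  \<comment> \<open>Inserting \<open>m\<close> keeps the maximum defined when \<open>P m\<close> is
    empty and yields \<open>m < L m\<close>; \<open>Suc\<close> makes the bound on the primes
    strict, as \<open>folner_box\<close> requires.\<close>
  define L where "L = (\<lambda>m. Suc (Max (insert m (P m))))"
  have L: "p < L m" if "p \<in> insert m (P m)" for p m
    unfolding L_def using that finP by (simp only: less_Suc_eq_le Max_ge finite_insert)
  let ?A = "{0<..} - (\<Union>m. removed P L m)"
  have "ereal (1 - \<epsilon>) < ereal (1 - \<delta>)" using \<delta> by simp
  also have "\<dots> \<le> mult_upper_banach_density ?A"
    using P L small \<delta>(1) by (intro density_removed_complement) (auto intro: less_imp_le)
  finally have "mult_upper_banach_density ?A > ereal (1 - \<epsilon>)" .
  moreover have "finite B" if "B \<subseteq> {0<..}" "t > 0" "k \<ge> 2" "scaled_prod_set t B k \<subseteq> of_nat ` ?A"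
    for B t k
  proof (rule ccontr)
    assume "infinite B"
    then have "\<exists>m. \<exists>n\<in>?A. n \<in> removed P L m"
      using that P finP by (intro scaled_prod_set_meets_removed[of P B t k]) auto
    then show False by auto
  qed
  ultimately show ?thesis by (intro exI[of _ ?A]) blast
qed

end
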